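(* Let $V:\Omega\to\mathbb{R}$ depend only on $w(0)$. The function $f(w)=\dfrac{(\mu_V)_{w(0)}}{p_0^{w(0)}}$ on $\Omega$ is an eigenfunction of $\mathcal{L}_V^t$ with eigenvalue $e^{t\lambda(V)}$ for every $t>0$; that is, $$\mathcal{L}_V^t(f)=e^{t\lambda(V)}f .$$
   Context: Let $S=\{1,\dots,n\}$ and let $L$ be a real $n\times n$ matrix with $L_{ii}<0$ for all $i$, $L_{ij}\ge 0$ for $i\ne j$, and $\sum_{i=1}^n L_{ij}=0$ for every $j$. Put $P^t=e^{tL}$ (column stochastic), and let $p_0=(p_0^1,\dots,p_0^n)$ be a probability vector with $Lp_0=0$ and all entries strictly positive. $\Omega$ is the set of right-continuous functions $w:[0,\infty)\to S$ with left limits, $\mathcal{B}$ is the $\sigma$-algebra generated by the coordinate maps $X_t(w)=w(t)$, and $\Theta_s:\Omega\to\Omega$ is $(\Theta_s w)(t)=w(t+s)$. For $t>0$ and $x\in\Omega$ let $\bar\mu_t^x$ be the measure on $(\Omega,\mathcal{B})$ (carried by $\Theta_t^{-1}(x)$) such that for $0=t_0<t_1<\dots<t_{j-1}<t\le t_j<\dots<t_r$ (no $t_k\ge t$ being allowed, in which case $j=r+1$) and $a_0,\dots,a_r\in S$, $$\bar\mu_t^x(X_{t_0}=a_0,\dots,X_{t_r}=a_r)=\frac{1}{p_0^{x(0)}}\,P^{t-t_{j-1}}_{x(0)\,a_{j-1}}\Big(\prod_{k=1}^{j-1}P^{t_k-t_{k-1}}_{a_k a_{k-1}}\Big)p_0^{a_0}$$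 if $a_k=x(t_k-t)$ for all $k\ge j$, and $0$ otherwise. For bounded measurable $\varphi$ define $\mathcal{L}^t(\varphi)(x)=\int\varphi\,d\bar\mu_t^x$ for every $x\in\Omega$. Let $V:\Omega\to\mathbb{R}$ satisfy $V(w)=V_{w(0)}$ for real numbers $V_1,\dots,V_n$; also write $V$ for the diagonal matrix with entries $V_i$. Let $\lambda(V)\in\mathbb{R}$ and let $\mu_V$ be a probability vector in $\mathbb{R}^n$ with strictly positive entries such that $e^{t(L+V)}\mu_V=e^{t\lambda(V)}\mu_V$ for all $t>0$. Define $\mathcal{L}_V^t(f)=\mathcal{L}^t\big(e^{\int_0^t V\circ\Theta_s\,ds}\,f\big)$ for bounded measurable $f$. *)

theory Defs
  imports "HOL-Analysis.Analysis"
begin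

text \<open>
  The state space \<open>S = {1, \<dots>, n}\<close> is a finite type \<open>'n\<close>. A function on \<open>[0, \<infinity>)\<close> is
  represented by the function on the reals that is \<^const>\<open>undefined\<close> outside \<open>{0..}\<close>.
\<close>

text \<open>\<open>*\<close> on \<open>real ^ 'n ^ 'n\<close> is the entrywise product, so neither \<open>^\<close> nor the library's
  \<^const>\<open>exp\<close> is the matrix notion; the series below uses the matrix product \<open>**\<close>.\<close>

primrec mat_power :: "real ^ 'n ^ 'n \<Rightarrow> nat \<Rightarrow> real ^ 'n ^ 'n" where
  "mat_power A 0 = mat 1"
| "mat_power A (Suc k) = A ** mat_power A k"

definition mat_exp :: "real ^ 'n ^ 'n \<Rightarrow> real ^ 'n ^ 'n" where
  "mat_exp A = (\<Sum>k. (1 / fact k) *\<^sub>R mat_power A k)"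

definition diag_mat :: "real ^ 'n \<Rightarrow> real ^ 'n ^ 'n" where
  "diag_mat v = (\<chi> i j. if i = j then v $ i else 0)"

definition transition_matrix :: "real ^ 'n ^ 'n \<Rightarrow> real \<Rightarrow> real ^ 'n ^ 'n" where
  "transition_matrix L t = mat_exp (t *\<^sub>R L)"

definition generator_matrix :: "real ^ 'n ^ 'n \<Rightarrow> bool" where
  "generator_matrix L \<longleftrightarrow>
     (\<forall>i. L $ i $ i < 0) \<and> (\<forall>i j. i \<noteq> j \<longrightarrow> 0 \<le> L $ i $ j) \<and> (\<forall>j. (\<Sum>i\<in>UNIV. L $ i $ j) = 0)"

definition positive_prob_vector :: "real ^ 'n \<Rightarrow> bool" where
  "positive_prob_vector p \<longleftrightarrow> (\<forall>i. 0 < p $ i) \<and> (\<Sum>i\<in>UNIV. p $ i) = 1"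

definition cadlag_paths :: "(real \<Rightarrow> 'n) set" where
  "cadlag_paths = {w \<in> extensional {0..}.
     (\<forall>t\<ge>0. limitin (discrete_topology UNIV) w (w t) (at_right t)) \<and>
     (\<forall>t>0. \<exists>a. limitin (discrete_topology UNIV) w a (at_left t))}"

text \<open>Of this measure space only the \<open>\<sigma>\<close>-algebra matters: \<^const>\<open>sigma\<close> carries the zero measure.\<close>

definition path_algebra :: "(real \<Rightarrow> 'n) measure" where
  "path_algebra = sigma cadlag_paths {{w \<in> cadlag_paths. w t \<in> A} | t A. 0 \<le> t}"

definition shift :: "real \<Rightarrow> (real \<Rightarrow> 'n) \<Rightarrow> (real \<Rightarrow> 'n)" where
  "shift s w = (\<lambda>t\<in>{0..}. w (t + s))"

text \<open>
  \<open>M\<close> is the measure \<open>\<mu>\<^sub>t\<^sup>x\<close>: its future from time \<open>t\<close> on is the path \<open>x\<close>, and its past is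
  given by cylinder values. The cylinder is \<open>X\<^bsub>\<tau> 0\<^esub> = a 0, \<dots>, X\<^bsub>\<tau> r\<^esub> = a r\<close>, where
  \<open>\<tau> 0, \<dots>, \<tau> (j - 1)\<close> lie before \<open>t\<close> and \<open>\<tau> j, \<dots>, \<tau> r\<close> do not; \<open>j = r + 1\<close> means that there
  are no times of the second kind. Only \<open>\<tau>\<close> and \<open>a\<close> on \<open>{..r}\<close> are used.
\<close>

definition is_conditional_measure ::
  "real ^ 'n ^ 'n \<Rightarrow> real ^ 'n \<Rightarrow> real \<Rightarrow> (real \<Rightarrow> 'n) \<Rightarrow> (real \<Rightarrow> 'n) measure \<Rightarrow> bool" where
  "is_conditional_measure L p0 t x M \<longleftrightarrow>
     space M = cadlag_paths \<and> sets M = sets path_algebra \<and>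
     (AE w in M. shift t w = x) \<and>
     (\<forall>(r::nat) j (\<tau> :: nat \<Rightarrow> real) a.
        1 \<le> j \<and> j \<le> r + 1 \<and> \<tau> 0 = 0 \<and> (\<forall>k<r. \<tau> k < \<tau> (Suc k)) \<and>
        \<tau> (j - 1) < t \<and> (j \<le> r \<longrightarrow> t \<le> \<tau> j) \<longrightarrow>
        emeasure M {w \<in> cadlag_paths. \<forall>k\<le>r. w (\<tau> k) = a k} =
          (if \<forall>k\<in>{j..r}. a k = x (\<tau> k - t)
           then ennreal (1 / p0 $ x 0 * transition_matrix L (t - \<tau> (j - 1)) $ x 0 $ a (j - 1) *
                  (\<Prod>k=1..j - 1. transition_matrix L (\<tau> k - \<tau> (k - 1)) $ a k $ a (k - 1)) *
                  p0 $ a 0)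
           else 0))"

definition transfer ::
  "(real \<Rightarrow> (real \<Rightarrow> 'n) \<Rightarrow> (real \<Rightarrow> 'n) measure) \<Rightarrow> real \<Rightarrow>
   ((real \<Rightarrow> 'n) \<Rightarrow> real) \<Rightarrow> (real \<Rightarrow> 'n) \<Rightarrow> real" where
  "transfer \<mu> t \<phi> x = (\<integral>w. \<phi> w \<partial>\<mu> t x)"

definition weighted_transfer ::
  "(real \<Rightarrow> (real \<Rightarrow> 'n) \<Rightarrow> (real \<Rightarrow> 'n) measure) \<Rightarrow> ((real \<Rightarrow> 'n) \<Rightarrow> real) \<Rightarrow> real \<Rightarrow>
   ((real \<Rightarrow> 'n) \<Rightarrow> real) \<Rightarrow> (real \<Rightarrow> 'n) \<Rightarrow> real" where
  "weighted_transfer \<mu> V t f =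
     transfer \<mu> t (\<lambda>w. exp (LINT s:{0..t}|lborel. V (shift s w)) * f w)"

definition bounded_measurable :: "((real \<Rightarrow> 'n) \<Rightarrow> real) set" where
  "bounded_measurable = {f \<in> borel_measurable path_algebra. bounded (f ` cadlag_paths)}"

text \<open>Values off \<^const>\<open>cadlag_paths\<close> are junk, hence the bounded quantifiers.\<close>

definition is_eigenfunction ::
  "(((real \<Rightarrow> 'n) \<Rightarrow> real) \<Rightarrow> (real \<Rightarrow> 'n) \<Rightarrow> real) \<Rightarrow> ((real \<Rightarrow> 'n) \<Rightarrow> real) \<Rightarrow> real \<Rightarrow> bool" where
  "is_eigenfunction T f c \<longleftrightarrow> f \<in> bounded_measurable \<and>
     (\<exists>w\<in>cadlag_paths. f w \<noteq> 0) \<and> (\<forall>w\<in>cadlag_paths. T f w = c * f w)"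

end

theory Submission
  imports Defs
begin

text \<open>
  Write \<open>h = t / N\<close>, \<open>P\<^sup>h = e\<^sup>h\<^sup>L\<close> and \<open>A\<^sub>h = e\<^sup>h\<^sup>V P\<^sup>h\<close>. When the exponent \<open>\<integral> V \<circ> \<Theta>\<^sub>s ds\<close> is
  replaced by a Riemann sum, the cylinder formula evaluates the weighted transfer operator on the
  function in question as \<open>A\<^sub>h\<^sup>N \<mu>\<^sub>V / p\<^sub>0\<close> at \<open>x(0)\<close>. Instead of the Trotter product formula
  it suffices to use that \<open>\<mu>\<^sub>V > 0\<close> is an eigenvector: comparing derivatives at \<open>h = 0\<close>, for every
  \<open>\<epsilon> > 0\<close> and all small \<open>h > 0\<close> one has
  \<open>e\<^bsup>h(\<lambda> - \<epsilon>)\<^esup> \<mu>\<^sub>V \<le> A\<^sub>h \<mu>\<^sub>V \<le> e\<^bsup>h(\<lambda> + \<epsilon>)\<^esup> \<mu>\<^sub>V\<close> entrywise, and \<open>A\<^sub>h\<close> has nonnegative entries, so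
  these bounds can be iterated \<open>N\<close> times. Dominated convergence and \<open>\<epsilon> \<rightarrow> 0\<close> finish the proof.
\<close>

section \<open>The matrix exponential, entry by entry\<close>

text \<open>A crude geometric bound, enough for comparison with a scalar exponential series. The
  induction generalizes the row \<open>i\<close> because peeling off the left factor of the power
  leads to other rows.\<close>

lemma abs_mat_power_entry_le:
  fixes A :: "real ^ 'n ^ 'n"
  shows "\<bar>mat_power A k $ i $ j\<bar> \<le> (\<Sum>i\<in>UNIV. \<Sum>j\<in>UNIV. \<bar>A $ i $ j\<bar>) ^ k"
proof (induction k arbitrary: i)
  case 0
  show ?case by (simp add: mat_def)
next
  case (Suc k)
  define C where "C = (\<Sum>i\<in>UNIV. \<Sum>j\<in>UNIV. \<bar>A $ i $ j\<bar>)"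
  have C: "C \<ge> 0" by (auto simp: C_def intro!: sum_nonneg)
  have row: "(\<Sum>l\<in>UNIV. \<bar>A $ i $ l\<bar>) \<le> C"
    unfolding C_def by (rule member_le_sum) (auto intro: sum_nonneg)
  have "\<bar>mat_power A (Suc k) $ i $ j\<bar> \<le> (\<Sum>l\<in>UNIV. \<bar>A $ i $ l * mat_power A k $ l $ j\<bar>)"
    by (simp add: matrix_matrix_mult_def sum_abs)
  also have "\<dots> \<le> (\<Sum>l\<in>UNIV. \<bar>A $ i $ l\<bar> * C ^ k)"
    unfolding abs_mult using Suc.IH by (intro sum_mono mult_left_mono) (auto simp: C_def)
  also have "\<dots> = (\<Sum>l\<in>UNIV. \<bar>A $ i $ l\<bar>) * C ^ k"
    by (simp add: sum_distrib_right)
  also have "\<dots> \<le> C * C ^ k"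
    using row C by (intro mult_right_mono) auto
  finally show ?case by (simp add: C_def)
qed

lemma summable_abs_mat_power_entry:
  fixes A :: "real ^ 'n ^ 'n"
  shows "summable (\<lambda>k. \<bar>mat_power A k $ i $ j / fact k\<bar>)"
proof (rule summable_comparison_test)
  let ?C = "\<Sum>i\<in>UNIV. \<Sum>j\<in>UNIV. \<bar>A $ i $ j\<bar>"
  show "\<exists>N. \<forall>k\<ge>N. norm \<bar>mat_power A k $ i $ j / fact k\<bar> \<le> inverse (fact k) * ?C ^ k"
    by (auto simp: abs_mat_power_entry_le field_simps)
  show "summable (\<lambda>k. inverse (fact k) * ?C ^ k)"
    by (rule summable_exp)
qed

text \<open>Limits of matrices are taken entry by entry, so the matrix series may be traded for
  scalar series. The value at 0, the derivative and the sign of \<open>mat_exp\<close> are all read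
  off from these.\<close>

lemma mat_exp_entry_sums:
  fixes A :: "real ^ 'n ^ 'n"
  shows "(\<lambda>k. mat_power A k $ i $ j / fact k) sums (mat_exp A $ i $ j)"
proof -
  let ?s = "\<chi> i j. \<Sum>k. mat_power A k $ i $ j / fact k"
  have "(\<lambda>k. mat_power A k $ i $ j / fact k) sums (?s $ i $ j)" for i j
    using summable_rabs_cancel[OF summable_abs_mat_power_entry[of A i j]]
    by (simp add: summable_sums)
  then have "(\<lambda>k. (1 / fact k) *\<^sub>R mat_power A k) sums ?s"
    unfolding sums_def by (intro vec_tendstoI) (simp add: sum_component)
  then have "mat_exp A = ?s"
    unfolding mat_exp_def by (rule sums_unique[symmetric])
  then show ?thesis
    using summable_rabs_cancel[OF summable_abs_mat_power_entry[of A i j]]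
    by (simp add: summable_sums)
qed

lemma mat_power_scaleR:
  fixes A :: "real ^ 'n ^ 'n"
  shows "mat_power (c *\<^sub>R A) k = c ^ k *\<^sub>R mat_power A k"
  by (induction k) (simp_all add: vec_eq_iff matrix_matrix_mult_def sum_distrib_left ac_simps)

lemma mat_exp_0: "mat_exp 0 = (mat 1 :: real ^ 'n ^ 'n)"
proof -
  have "mat_power (0 :: real ^ 'n ^ 'n) k $ i $ j / fact k =
      (if k = 0 then (mat 1 :: real ^ 'n ^ 'n) $ i $ j else 0)" for k and i j :: 'n
    by (cases k) (simp_all add: matrix_matrix_mult_def)
  then have "mat_exp (0 :: real ^ 'n ^ 'n) $ i $ j = (mat 1 :: real ^ 'n ^ 'n) $ i $ j" for i j
    using mat_exp_entry_sums[of "0 :: real ^ 'n ^ 'n" i j]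
      sums_single[of 0 "\<lambda>_. (mat 1 :: real ^ 'n ^ 'n) $ i $ j"]
    by (simp add: sums_unique2)
  then show ?thesis by (simp add: vec_eq_iff)
qed

text \<open>In \<open>h\<close> the entry is an everywhere convergent power series, so its
  derivative at 0 is the coefficient of index 1, which comes from
  \<open>mat_power A 1 = A\<close>.\<close>

lemma mat_exp_entry_has_derivative:
  fixes A :: "real ^ 'n ^ 'n"
  shows "((\<lambda>h. mat_exp (h *\<^sub>R A) $ i $ j) has_real_derivative A $ i $ j) (at 0)"
proof -
  let ?c = "\<lambda>k. mat_power A k $ i $ j / fact k"
  have sums: "(\<lambda>k. ?c k * h ^ k) sums (mat_exp (h *\<^sub>R A) $ i $ j)" for h
    using mat_exp_entry_sums[of "h *\<^sub>R A" i j] by (simp add: mat_power_scaleR mult.commute)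
  have "((\<lambda>h. \<Sum>k. ?c k * h ^ k) has_field_derivative (\<Sum>k. diffs ?c k * 0 ^ k)) (at 0)"
    by (rule termdiffs_strong_converges_everywhere) (use sums in \<open>auto simp: sums_iff\<close>)
  moreover have "(\<Sum>k. diffs ?c k * 0 ^ k) = A $ i $ j"
    unfolding powser_zero by (simp add: diffs_def)
  ultimately show ?thesis
    using sums by (simp add: sums_iff)
qed

text \<open>The binomial theorem, valid because a scalar matrix commutes with \<open>Q\<close>. It
  identifies the Cauchy product of the series for \<open>Q\<close> and for the scalar
  \<open>c\<close> with the series for their sum.\<close>

lemma mat_power_add_scalar:
  fixes Q :: "real ^ 'n ^ 'n"
  shows "mat_power (Q + c *\<^sub>R mat 1) k $ i $ j =
    (\<Sum>l\<le>k. real (k choose l) * mat_power Q l $ i $ j * c ^ (k - l))"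
proof (induction k arbitrary: i)
  case 0
  show ?case by simp
next
  case (Suc k)
  define q where "q l = mat_power Q l $ i $ j" for l
  have q_Suc: "q (Suc l) = (\<Sum>m\<in>UNIV. Q $ i $ m * mat_power Q l $ m $ j)" for l
    by (simp add: q_def matrix_matrix_mult_def)
  have mult: "((Q + c *\<^sub>R mat 1) ** B) $ i $ j = (Q ** B) $ i $ j + c * B $ i $ j"
    for B :: "real ^ 'n ^ 'n"
  proof -
    have "(\<Sum>m\<in>UNIV. c * (if i = m then 1 else 0) * B $ m $ j) =
        (\<Sum>m\<in>UNIV. if i = m then c * B $ m $ j else 0)"
      by (intro sum.cong) auto
    then show ?thesis
      by (simp add: matrix_matrix_mult_def mat_def distrib_right sum.distrib)
  qed
  have "mat_power (Q + c *\<^sub>R mat 1) (Suc k) $ i $ j =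
      (\<Sum>m\<in>UNIV. Q $ i $ m * mat_power (Q + c *\<^sub>R mat 1) k $ m $ j)
      + c * mat_power (Q + c *\<^sub>R mat 1) k $ i $ j"
    by (simp add: mult) (simp add: matrix_matrix_mult_def)
  also have "(\<Sum>m\<in>UNIV. Q $ i $ m * mat_power (Q + c *\<^sub>R mat 1) k $ m $ j) =
      (\<Sum>l\<le>k. real (k choose l) * q (Suc l) * c ^ (k - l))"
    unfolding Suc.IH q_Suc sum_distrib_left sum_distrib_right
    by (subst sum.swap) (simp add: mult_ac)
  also have "c * mat_power (Q + c *\<^sub>R mat 1) k $ i $ j =
      (\<Sum>l\<le>k. real (k choose l) * q l * c ^ (Suc k - l))"
    unfolding Suc.IH sum_distrib_left
    by (intro sum.cong) (auto simp: q_def Suc_diff_le)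
  \<comment> \<open>The added top term vanishes since \<open>k choose Suc k = 0\<close>. Once the
    term \<open>l = 0\<close> is split off, the two sums merge by Pascal's rule.\<close>
  also have "\<dots> = (\<Sum>l\<le>Suc k. real (k choose l) * q l * c ^ (Suc k - l))"
    by simp
  also have "\<dots> = q 0 * c ^ Suc k + (\<Sum>l\<le>k. real (k choose Suc l) * q (Suc l) * c ^ (k - l))"
    by (subst sum.atMost_Suc_shift) simp
  also have "(\<Sum>l\<le>k. real (k choose l) * q (Suc l) * c ^ (k - l)) + \<dots> =
      (\<Sum>l\<le>Suc k. real (Suc k choose l) * q l * c ^ (Suc k - l))"
    by (subst sum.atMost_Suc_shift) (simp add: algebra_simps sum.distrib)
  finally show ?case by (simp only: q_def)
qed

lemma mat_power_nonneg:
  fixes Q :: "real ^ 'n ^ 'n"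
  assumes "\<And>i j. 0 \<le> Q $ i $ j"
  shows "0 \<le> mat_power Q k $ i $ j"
  by (induction k arbitrary: i) (simp_all add: mat_def matrix_matrix_mult_def assms sum_nonneg)

lemma mat_exp_nonneg:
  fixes A :: "real ^ 'n ^ 'n"
  assumes "\<And>i j. i \<noteq> j \<Longrightarrow> 0 \<le> A $ i $ j"
  shows "0 \<le> mat_exp A $ i $ j"
proof -
  \<comment> \<open>Shifting the diagonal: \<open>e\<^sup>A = e\<^sup>-\<^sup>c e\<^bsup>A + c\<^esup>\<close>, where \<open>A + c\<close> has nonnegative entries.\<close>
  define c where "c = (\<Sum>i\<in>UNIV. \<bar>A $ i $ i\<bar>)"
  define Q where "Q = A + c *\<^sub>R mat 1"
  have diag: "\<bar>A $ i $ i\<bar> \<le> c" for i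
    unfolding c_def by (rule member_le_sum) auto
  have Q: "0 \<le> Q $ i $ j" for i j
    using assms[of i j] diag[of i] by (auto simp: Q_def mat_def)
  let ?a = "\<lambda>l. mat_power Q l $ i $ j / fact l"
  let ?b = "\<lambda>l. (- c) ^ l / fact l"
  have A: "A = Q + (- c) *\<^sub>R mat 1" by (simp add: Q_def)
  have b: "?b sums exp (- c)"
    using exp_converges[of "- c"] by (simp add: field_simps)
  have "(\<lambda>k. \<Sum>l\<le>k. ?a l * ?b (k - l)) sums ((\<Sum>k. ?a k) * (\<Sum>k. ?b k))"
  proof (rule Cauchy_product_sums)
    show "summable (\<lambda>k. norm (?a k))"
      using summable_abs_mat_power_entry[of Q i j] by simp
    show "summable (\<lambda>k. norm (?b k))"
      using summable_norm_exp[of "- c"] by (simp add: field_simps)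
  qed
  moreover have "(\<Sum>l\<le>k. ?a l * ?b (k - l)) = mat_power A k $ i $ j / fact k" for k
    unfolding A mat_power_add_scalar sum_divide_distrib
    by (intro sum.cong) (auto simp: binomial_fact field_simps)
  ultimately have "mat_exp A $ i $ j = (\<Sum>k. ?a k) * exp (- c)"
    using mat_exp_entry_sums[of A i j] b by (simp add: sums_unique2 sums_iff)
  moreover have "0 \<le> (\<Sum>k. ?a k)"
    using mat_exp_entry_sums[of Q i j] mat_power_nonneg[OF Q]
    by (intro suminf_nonneg) (auto simp: sums_iff)
  ultimately show ?thesis by simp
qed

section \<open>One small time step applied to the eigenvector\<close>

text \<open>At \<open>h = 0\<close> all three expressions equal \<open>m $ i\<close>. There the
  middle one has slope \<open>lam * m $ i\<close> and the outer ones
  \<open>(lam - e) * m $ i\<close> and \<open>(lam + e) * m $ i\<close>, so both gaps grow at rate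
  \<open>e * m $ i > 0\<close> just to the right of 0. Finitely many \<open>i\<close> share a common
  range of \<open>h\<close>.\<close>

lemma eventually_eigenvector_step_bounds:
  fixes L :: "real ^ 'n ^ 'n" and v m :: "real ^ 'n"
  assumes pos: "\<And>i. 0 < m $ i" and e: "0 < e"
    and eig: "\<And>t. t > 0 \<Longrightarrow> mat_exp (t *\<^sub>R (L + diag_mat v)) *v m = exp (t * lam) *\<^sub>R m"
  shows "eventually (\<lambda>h. \<forall>i.
      exp (h * (lam - e)) * m $ i \<le> exp (h * v $ i) * (\<Sum>j\<in>UNIV. mat_exp (h *\<^sub>R L) $ i $ j * m $ j) \<and>
      exp (h * v $ i) * (\<Sum>j\<in>UNIV. mat_exp (h *\<^sub>R L) $ i $ j * m $ j) \<le> exp (h * (lam + e)) * m $ i)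
    (at_right 0)"
proof -
  have entry0: "mat_exp 0 $ i $ j = (if i = j then 1 else 0)" for i j :: 'n
    by (simp add: mat_exp_0 mat_def)
  have mvec: "(\<Sum>j\<in>UNIV. (if i = j then 1 else 0) * m $ j) = m $ i" for i
    by (simp add: if_distrib[of "\<lambda>x. x * _"] cong: if_cong)
  have DS: "((\<lambda>h. \<Sum>j\<in>UNIV. mat_exp (h *\<^sub>R A) $ i $ j * m $ j) has_real_derivative
      (\<Sum>j\<in>UNIV. A $ i $ j * m $ j)) (at 0)" for A i
    by (intro DERIV_sum DERIV_cmult_right mat_exp_entry_has_derivative)
  \<comment> \<open>The infinitesimal eigenvector equation, found by differentiating
    \<open>eig\<close> at 0. As \<open>eig\<close> speaks of positive times only, right-hand
    difference quotients are compared, and the values at 0 are matched separately.\<close>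
  have gen: "v $ i * m $ i + (\<Sum>j\<in>UNIV. L $ i $ j * m $ j) = lam * m $ i" for i
  proof -
    let ?f = "\<lambda>h. \<Sum>j\<in>UNIV. mat_exp (h *\<^sub>R (L + diag_mat v)) $ i $ j * m $ j"
    let ?g = "\<lambda>h. exp (h * lam) * m $ i"
    have right_slope: "((\<lambda>h. (F h - F 0) / h) \<longlongrightarrow> D) (at_right 0)"
      if "(F has_real_derivative D) (at 0)" for F :: "real \<Rightarrow> real" and D
      using filterlim_at_split[THEN iffD1] that by (auto simp: has_field_derivative_iff)
    have "(?g has_real_derivative lam * m $ i) (at 0)"
      by (auto intro!: derivative_eq_intros)
    then have lim_g: "((\<lambda>h. (?g h - ?g 0) / h) \<longlongrightarrow> lam * m $ i) (at_right 0)"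
      by (rule right_slope)
    have lim_f: "((\<lambda>h. (?f h - ?f 0) / h) \<longlongrightarrow> (\<Sum>j\<in>UNIV. (L + diag_mat v) $ i $ j * m $ j))
        (at_right 0)"
      by (rule right_slope[OF DS])
    have "eventually (\<lambda>h. (?f h - ?f 0) / h = (?g h - ?g 0) / h) (at_right 0)"
      using eventually_at_right_less
    proof eventually_elim
      case (elim h)
      have "?f h = ?g h"
        using arg_cong[OF eig[OF elim], of "\<lambda>x. x $ i"] by (simp add: matrix_vector_mult_def)
      moreover have "?f 0 = ?g 0"
        by (simp only: scaleR_zero_left entry0 mvec) simp
      ultimately show ?case by (simp only:)
    qed
    then have "((\<lambda>h. (?g h - ?g 0) / h) \<longlongrightarrow> (\<Sum>j\<in>UNIV. (L + diag_mat v) $ i $ j * m $ j)) (at_right 0)"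
      by (rule Lim_transform_eventually[OF lim_f])
    then have "lam * m $ i = (\<Sum>j\<in>UNIV. (L + diag_mat v) $ i $ j * m $ j)"
      by (rule tendsto_unique[OF trivial_limit_at_right_real lim_g])
    also have "\<dots> = (\<Sum>j\<in>UNIV. L $ i $ j * m $ j) + (\<Sum>j\<in>UNIV. if i = j then v $ i * m $ i else 0)"
      unfolding sum.distrib[symmetric] by (intro sum.cong) (auto simp: diag_mat_def distrib_right)
    finally show ?thesis by simp
  qed
  define G where "G i h = exp (h * v $ i) * (\<Sum>j\<in>UNIV. mat_exp (h *\<^sub>R L) $ i $ j * m $ j)" for i h
  have G0: "G i 0 = m $ i" for i
    by (simp add: G_def entry0 mvec)
  \<comment> \<open>To first order in \<open>h\<close>, the product of the exponentials of
    \<open>h V\<close> and \<open>h L\<close> agrees with the exponential of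
    \<open>h (L + V)\<close>: the product rule yields exactly the left side of
    \<open>gen\<close>.\<close>
  have DG: "(G i has_real_derivative lam * m $ i) (at 0)" for i
  proof -
    have "((\<lambda>h. exp (h * v $ i)) has_real_derivative v $ i) (at 0)"
      by (auto intro!: derivative_eq_intros)
    from DERIV_mult[OF this DS[of L i]] show ?thesis
      unfolding G_def by (simp add: entry0 mvec gen[symmetric] add.commute mult.commute[of _ "v $ i"])
  qed
  have pos_right: "eventually (\<lambda>h. 0 \<le> F h) (at_right 0)"
    if F: "(F has_real_derivative D) (at 0)" "0 < D" "F 0 = 0" for F :: "real \<Rightarrow> real" and D
  proof -
    obtain d where "d > 0" "\<And>h. 0 < h \<Longrightarrow> h < d \<Longrightarrow> F 0 < F (0 + h)"
      using DERIV_pos_inc_right[OF F(1,2)] by auto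
    then show ?thesis
      unfolding eventually_at_right_field using F(3) by (intro exI[of _ d]) force
  qed
  have "eventually (\<lambda>h. 0 \<le> G i h - exp (h * (lam - e)) * m $ i) (at_right 0)" for i
  proof (rule pos_right)
    show "((\<lambda>h. G i h - exp (h * (lam - e)) * m $ i) has_real_derivative e * m $ i) (at 0)"
      by (rule derivative_eq_intros DG refl)+ (simp add: algebra_simps)
  qed (use pos e in \<open>auto simp: G0\<close>)
  moreover have "eventually (\<lambda>h. 0 \<le> exp (h * (lam + e)) * m $ i - G i h) (at_right 0)" for i
  proof (rule pos_right)
    show "((\<lambda>h. exp (h * (lam + e)) * m $ i - G i h) has_real_derivative e * m $ i) (at 0)"
      by (rule derivative_eq_intros DG refl)+ (simp add: algebra_simps)
  qed (use pos e in \<open>auto simp: G0\<close>)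
  ultimately show ?thesis
    unfolding G_def[symmetric] by (auto intro!: eventually_all_finite eventually_conj)
qed

section \<open>Sums over words and iterated kernels\<close>

lemma sum_PiE_insert:
  fixes F :: "('i \<Rightarrow> 'a) \<Rightarrow> 'b :: comm_monoid_add"
  assumes "x \<notin> I"
  shows "(\<Sum>a\<in>PiE (insert x I) B. F a) = (\<Sum>y\<in>B x. \<Sum>a\<in>PiE I B. F (a(x := y)))"
proof -
  have "(\<Sum>a\<in>PiE (insert x I) B. F a) = (\<Sum>(y, a)\<in>B x \<times> PiE I B. F (a(x := y)))"
    unfolding PiE_insert_eq
    by (subst sum.reindex[OF inj_combinator[OF assms]]) (simp add: case_prod_beta o_def)
  then show ?thesis by (simp add: sum.cartesian_product)
qed

text \<open>A power of a kernel is a sum over paths. The letters \<open>a 0\<close>, ...,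
  \<open>a N\<close> together with the fixed end \<open>i\<close> give \<open>N + 1\<close>
  transitions, hence \<open>Suc N\<close> iterations. Peeling off the last letter turns it into the
  end of a shorter word, so \<open>i\<close> must be arbitrary in the induction.\<close>

lemma sum_words_eq_iterate:
  fixes K :: "'a :: finite \<Rightarrow> 'a \<Rightarrow> real"
  shows "(\<Sum>a\<in>PiE {..N} (\<lambda>_. UNIV). K i (a N) * (\<Prod>k=1..N. K (a k) (a (k - 1))) * g (a 0)) =
    ((\<lambda>f i. \<Sum>j\<in>UNIV. K i j * f j) ^^ Suc N) g i"
proof (induction N arbitrary: i)
  case 0
  have "{..0::nat} = insert 0 {}" by auto
  then show ?case by (simp add: sum_PiE_insert)
next
  case (Suc N)
  let ?T = "\<lambda>f i. \<Sum>j\<in>UNIV. K i j * f j"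
  have "(\<Sum>a\<in>PiE {..Suc N} (\<lambda>_. UNIV). K i (a (Suc N)) * (\<Prod>k=1..Suc N. K (a k) (a (k - 1))) * g (a 0)) =
      (\<Sum>y\<in>UNIV. \<Sum>a\<in>PiE {..N} (\<lambda>_. UNIV).
        K i y * (K y (a N) * (\<Prod>k=1..N. K (a k) (a (k - 1))) * g (a 0)))"
    unfolding atMost_Suc
    by (subst sum_PiE_insert) (auto simp: mult_ac intro!: sum.cong prod.cong)
  also have "\<dots> = (\<Sum>y\<in>UNIV. K i y * (?T ^^ Suc N) g y)"
    unfolding sum_distrib_left[symmetric] Suc.IH ..
  finally show ?case by simp
qed

section \<open>Cadlag paths, shifts and Riemann sums\<close>

text \<open>The singleton \<open>{a}\<close> is open in the discrete topology. Cadlag paths are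
  therefore constant just after each time and just before each positive time.\<close>

lemma limitin_discrete_iff:
  "limitin (discrete_topology UNIV) f a F \<longleftrightarrow> eventually (\<lambda>u. f u = a) F"
proof
  assume "limitin (discrete_topology UNIV) f a F"
  then have "eventually (\<lambda>u. f u \<in> {a}) F"
    unfolding limitin_def by (auto dest: spec[of _ "{a}"])
  then show "eventually (\<lambda>u. f u = a) F" by simp
qed (auto simp: limitin_def elim: eventually_mono)

lemma shift_in_cadlag_paths:
  assumes "w \<in> cadlag_paths" "0 \<le> s"
  shows "shift s w \<in> cadlag_paths"
proof -
  have right: "\<exists>d>t. \<forall>u>t. u < d \<longrightarrow> w u = w t" if "0 \<le> t" for t
    using assms that
    by (auto simp: cadlag_paths_def limitin_discrete_iff eventually_at_right_field)
  have left: "\<exists>a. \<exists>d<t. \<forall>u>d. u < t \<longrightarrow> w u = a" if "0 < t" for t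
    using assms that
    by (auto simp: cadlag_paths_def limitin_discrete_iff eventually_at_left_field)
  have "eventually (\<lambda>u. shift s w u = shift s w t) (at_right t)" if t: "0 \<le> t" for t
  proof -
    obtain d where d: "d > t + s" "\<And>u. t + s < u \<Longrightarrow> u < d \<Longrightarrow> w u = w (t + s)"
      using right[OF add_nonneg_nonneg[OF t assms(2)]] by blast
    show ?thesis
      unfolding eventually_at_right_field
      by (rule exI[of _ "d - s"]) (use t d in \<open>auto simp: shift_def\<close>)
  qed
  moreover have "\<exists>a. eventually (\<lambda>u. shift s w u = a) (at_left t)" if t: "0 < t" for t
  proof -
    obtain a d where d: "d < t + s" "\<And>u. d < u \<Longrightarrow> u < t + s \<Longrightarrow> w u = a"
      using left[OF add_pos_nonneg[OF t assms(2)]] by blast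
    \<comment> \<open>The bound \<open>d - s\<close> may be negative; the maximum with 0 keeps
      \<open>u\<close> where \<open>shift s w\<close> is not the default value
      \<open>undefined\<close>.\<close>
    have "eventually (\<lambda>u. shift s w u = a) (at_left t)"
      unfolding eventually_at_left_field
      by (rule exI[of _ "max 0 (d - s)"]) (use t d in \<open>auto simp: shift_def\<close>)
    then show ?thesis ..
  qed
  ultimately show ?thesis
    by (auto simp: cadlag_paths_def limitin_discrete_iff shift_def)
qed

text \<open>
  With right endpoints, right continuity gives convergence of the step functions at every point, so
  the countability of the set of jumps is not needed.
\<close>

lemma riemann_sum_cadlag_tendsto:
  fixes f :: "'n :: finite \<Rightarrow> real"
  assumes w: "w \<in> cadlag_paths" and t: "0 < t"
  shows "(\<lambda>N. \<Sum>k<Suc N. t / real (Suc N) * f (w (real (Suc k) * (t / real (Suc N)))))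
    \<longlonglongrightarrow> (LINT s:{0..t}|lborel. f (w s))"
proof -
  define h where "h N = t / real (Suc N)" for N
  have h: "0 < h N" "real (Suc N) * h N = t" for N
    using t by (auto simp: h_def)
  define g where "g N s = (\<Sum>k<Suc N. f (w (real (Suc k) * h N)) * indicator {real k * h N..<real (Suc k) * h N} s)" for N s
  define B where "B = (\<Sum>i\<in>UNIV. \<bar>f i\<bar>)"
  have B: "\<bar>f i\<bar> \<le> B" for i
    unfolding B_def by (rule member_le_sum) auto
  \<comment> \<open>The floor selects the cell containing \<open>s\<close>. The path is sampled at
    the right end of that cell, which lies strictly above \<open>s\<close>.\<close>
  have g_eq: "g N s = indicator {0..<t} s * f (w ((of_int \<lfloor>s / h N\<rfloor> + 1) * h N))" for N s
  proof -
    have *: "s \<in> {real k * h N..<real (Suc k) * h N} \<longleftrightarrow> \<lfloor>s / h N\<rfloor> = int k" for k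
      using h(1)[of N] by (simp add: floor_eq_iff field_simps)
    show ?thesis
    proof (cases "s \<in> {0..<t}")
      case True
      define k where "k = nat \<lfloor>s / h N\<rfloor>"
      have k: "\<lfloor>s / h N\<rfloor> = int k" using True h(1)[of N] by (simp add: k_def)
      have "real k * h N \<le> s" using *[of k] k by auto
      then have "real k * h N < real (Suc N) * h N" using True h(2)[of N] by simp
      then have "k < Suc N" using h(1)[of N] by simp
      have "g N s = (\<Sum>l<Suc N. if l = k then f (w (real (Suc k) * h N)) else 0)"
        unfolding g_def by (intro sum.cong) (auto simp: indicator_def * k simp del: atLeastLessThan_iff of_nat_Suc)
      also have "\<dots> = f (w (real (Suc k) * h N))" using \<open>k < Suc N\<close> by simp
      finally show ?thesis using True k by (simp add: add.commute)
    next
      case False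
      have "indicator {real k * h N..<real (Suc k) * h N} s = (0::real)" if "k < Suc N" for k
      proof -
        have "real (Suc k) * h N \<le> real (Suc N) * h N" "0 \<le> real k * h N"
          using that h(1)[of N] by (auto intro!: mult_right_mono mult_nonneg_nonneg)
        with False h(2)[of N] show ?thesis by (auto simp: indicator_def)
      qed
      then show ?thesis using False by (simp add: g_def)
    qed
  qed
  have lim: "(\<lambda>N. g N s) \<longlonglongrightarrow> indicator {0..<t} s * f (w s)" for s
  proof (cases "s \<in> {0..<t}")
    case True
    have "eventually (\<lambda>u. w u = w s) (at_right s)"
      using w True by (auto simp: cadlag_paths_def limitin_discrete_iff)
    then obtain d where d: "d > s" "\<And>u. s < u \<Longrightarrow> u < d \<Longrightarrow> w u = w s"
      by (auto simp: eventually_at_right_field)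
    have "h \<longlonglongrightarrow> 0"
      unfolding h_def by (rule LIMSEQ_Suc) (rule lim_const_over_n)
    then have "eventually (\<lambda>N. h N < d - s) sequentially"
      using d(1) by (intro order_tendstoD) auto
    then have "eventually (\<lambda>N. g N s = indicator {0..<t} s * f (w s)) sequentially"
    proof eventually_elim
      case (elim N)
      \<comment> \<open>The sample point lies above \<open>s\<close> by at most \<open>h N\<close>,
        hence before \<open>d\<close>, where the path still has the value
        \<open>w s\<close>.\<close>
      have "of_int \<lfloor>s / h N\<rfloor> * h N \<le> s" "s < (of_int \<lfloor>s / h N\<rfloor> + 1) * h N"
        using of_int_floor_le[of "s / h N"] real_of_int_floor_add_one_gt[of "s / h N"]
        unfolding pos_le_divide_eq[OF h(1)] pos_divide_less_eq[OF h(1)] by blast+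
      then show ?case
        using d(2)[of "(of_int \<lfloor>s / h N\<rfloor> + 1) * h N"] elim by (simp add: g_eq distrib_right)
    qed
    then show ?thesis by (rule tendsto_eventually)
  qed (simp add: g_eq)
  have meas: "g N \<in> borel_measurable lborel" for N
    unfolding g_def by measurable
  have "(\<lambda>N. LINT s|lborel. g N s) \<longlonglongrightarrow> (LINT s|lborel. indicator {0..<t} s * f (w s))"
  proof (rule integral_dominated_convergence)
    \<comment> \<open>Measurability along the path is inherited from the step functions
      \<open>g N\<close>.\<close>
    show "(\<lambda>s. indicator {0..<t} s * f (w s)) \<in> borel_measurable lborel"
      using lim meas by (rule borel_measurable_LIMSEQ_real)
    show "integrable lborel (\<lambda>s. indicator {0..t} s * B)"
      by (intro integrable_mult_left impI integrable_real_indicator) (auto simp: emeasure_lborel_Icc_eq)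
    show "AE s in lborel. norm (g N s) \<le> indicator {0..t} s * B" for N
      using B order_trans[OF abs_ge_zero B] by (auto simp: g_eq indicator_def)
  qed (use lim meas in auto)
  moreover have "(LINT s|lborel. g N s) = (\<Sum>k<Suc N. h N * f (w (real (Suc k) * h N)))" for N
  proof -
    have le: "real k * h N \<le> real (Suc k) * h N" for k
      using h(1)[of N] by (intro mult_right_mono) auto
    have "(LINT s|lborel. g N s) = (\<Sum>k<Suc N. f (w (real (Suc k) * h N)) *
        measure lborel {real k * h N..<real (Suc k) * h N})"
      unfolding g_def using le
      by (subst Bochner_Integration.integral_sum) (auto intro!: integrable_real_indicator)
    also have "\<dots> = (\<Sum>k<Suc N. h N * f (w (real (Suc k) * h N)))"
      using h(1)[of N] by (intro sum.cong) (auto simp: algebra_simps)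
    finally show ?thesis .
  qed
  \<comment> \<open>The cells cover only \<open>{0..<t}\<close>; the remaining point
    \<open>t\<close> is a null set.\<close>
  moreover have "(LINT s|lborel. indicator {0..<t} s * f (w s)) = (LINT s:{0..t}|lborel. f (w s))"
  proof -
    have [measurable]: "(\<lambda>s. indicator {0..<t} s * f (w s)) \<in> borel_measurable lborel"
      using lim meas by (rule borel_measurable_LIMSEQ_real)
    have eq: "indicator {0..t} s * f (w s) = indicator {0..<t} s * f (w s) + indicator {t} s * f (w t)" for s
      using t by (auto simp: indicator_def)
    have "(LINT s|lborel. indicator {0..<t} s * f (w s)) = (LINT s|lborel. indicator {0..t} s * f (w s))"
      unfolding eq
    proof (rule integral_cong_AE)
      show "AE s in lborel. indicator {0..<t} s * f (w s) =
          indicator {0..<t} s * f (w s) + indicator {t} s * f (w t)"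
        using AE_lborel_singleton[of t] by eventually_elim simp
    qed measurable
    then show ?thesis by (simp add: set_lebesgue_integral_def)
  qed
  ultimately show ?thesis by (simp add: h_def)
qed

section \<open>Integrals against the conditional measure\<close>

lemma measurable_coordinate:
  assumes "0 \<le> t"
  shows "(\<lambda>w. w t) \<in> path_algebra \<rightarrow>\<^sub>M count_space UNIV"
proof (rule measurableI)
  fix A :: "'a set"
  have gen: "{{w \<in> cadlag_paths. w t \<in> A} | t A. 0 \<le> t} \<subseteq> Pow (cadlag_paths :: (real \<Rightarrow> 'a) set)"
    by auto
  have "(\<lambda>w. w t) -` A \<inter> space path_algebra = {w \<in> cadlag_paths. w t \<in> A}"
    by (auto simp: path_algebra_def space_measure_of_conv)
  moreover have "{w \<in> cadlag_paths. w t \<in> A} \<in> sets path_algebra"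
    unfolding path_algebra_def sets_measure_of[OF gen] using assms by (intro sigma_sets.Basic) auto
  ultimately show "(\<lambda>w. w t) -` A \<inter> space path_algebra \<in> sets path_algebra" by simp
qed simp

lemma measurable_coordinate_of_sets_eq:
  assumes "sets M = sets path_algebra" "0 \<le> t"
  shows "(\<lambda>w. w t) \<in> M \<rightarrow>\<^sub>M count_space UNIV"
  using measurable_coordinate[OF assms(2)] measurable_cong_sets[OF assms(1) refl] by blast

text \<open>With finitely many letters, the cylinders over the chosen times form a finite partition
  of the path space, and the integrand is constant on each of them. Extensional words make the
  cylinder containing a given path unique.\<close>

lemma integral_finite_coordinates:
  fixes M :: "(real \<Rightarrow> 'n :: finite) measure" and F :: "(nat \<Rightarrow> 'n) \<Rightarrow> real"
  assumes fin: "finite_measure M" and space: "space M = cadlag_paths"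
    and sets: "sets M = sets path_algebra" and \<tau>: "\<And>k. 0 \<le> \<tau> k"
  shows "(\<integral>w. F (\<lambda>k\<in>{..N}. w (\<tau> k)) \<partial>M) =
    (\<Sum>a\<in>PiE {..N} (\<lambda>_. UNIV). F a * measure M {w \<in> cadlag_paths. \<forall>k\<le>N. w (\<tau> k) = a k})"
proof -
  interpret finite_measure M by fact
  let ?C = "\<lambda>a. {w \<in> cadlag_paths. \<forall>k\<le>N. w (\<tau> k) = a k}"
  have C: "?C a \<in> sets M" for a
  proof -
    have "{w \<in> space M. w (\<tau> k) = a k} \<in> sets M" for k
      using measurable_sets[OF measurable_coordinate_of_sets_eq[OF sets \<tau>[of k]], of "{a k}"]
      by (simp add: vimage_def Int_def conj_commute)
    then have "{w \<in> space M. \<forall>k\<in>{..N}. w (\<tau> k) = a k} \<in> sets M"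
      by (intro sets.sets_Collect_finite_All) auto
    moreover have "?C a = {w \<in> space M. \<forall>k\<in>{..N}. w (\<tau> k) = a k}"
      by (auto simp: space)
    ultimately show ?thesis by simp
  qed
  have fin_words: "finite (PiE {..N} (\<lambda>_. UNIV :: 'n set))"
    by (intro finite_PiE) auto
  have "(\<integral>w. F (\<lambda>k\<in>{..N}. w (\<tau> k)) \<partial>M) =
      (\<integral>w. (\<Sum>a\<in>PiE {..N} (\<lambda>_. UNIV). F a * indicator (?C a) w) \<partial>M)"
  proof (rule Bochner_Integration.integral_cong)
    fix w assume w: "w \<in> space M"
    let ?b = "\<lambda>k\<in>{..N}. w (\<tau> k)"
    have "F a * indicator (?C a) w = (if a = ?b then F ?b else 0)" if "a \<in> PiE {..N} (\<lambda>_. UNIV)" for a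
    proof -
      have "w \<in> ?C a \<longleftrightarrow> (\<forall>k\<in>{..N}. a k = w (\<tau> k))"
        using w by (auto simp: space)
      also have "\<dots> \<longleftrightarrow> a = ?b"
      proof
        assume "\<forall>k\<in>{..N}. a k = w (\<tau> k)"
        then have "restrict a {..N} = ?b" by (intro restrict_ext) simp
        then show "a = ?b" using PiE_restrict[OF that] by simp
      qed (simp add: restrict_def)
      finally have "w \<in> ?C a \<longleftrightarrow> a = ?b" .
      then show ?thesis by (simp add: indicator_def)
    qed
    then have "(\<Sum>a\<in>PiE {..N} (\<lambda>_. UNIV). F a * indicator (?C a) w) =
        (\<Sum>a\<in>PiE {..N} (\<lambda>_. UNIV). if a = ?b then F ?b else 0)"
      by (intro sum.cong refl)
    also have "\<dots> = F ?b"
      using fin_words by (simp add: sum.delta)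
    finally show "F ?b = (\<Sum>a\<in>PiE {..N} (\<lambda>_. UNIV). F a * indicator (?C a) w)" by (rule sym)
  qed (rule refl)
  also have "\<dots> = (\<Sum>a\<in>PiE {..N} (\<lambda>_. UNIV). F a * measure M (?C a))"
  proof -
    have int: "integrable M (\<lambda>w. F a * indicator (?C a) w)" for a
      using C[of a] emeasure_finite[of "?C a"]
      by (intro integrable_mult_right integrable_real_indicator) (simp_all only: infinity_ennreal_def less_top)
    have "(\<integral>w. F a * indicator (?C a) w \<partial>M) = F a * measure M (?C a)" for a
    proof -
      have "?C a \<inter> space M = ?C a"
        by (auto simp: space)
      then have "integral\<^sup>L M (indicator (?C a) :: _ \<Rightarrow> real) = measure M (?C a)"
        using Bochner_Integration.integral_indicator[of M "?C a"] by (simp only:)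
      then show ?thesis
        by (simp only: integral_mult_right_zero)
    qed
    then show ?thesis
      unfolding Bochner_Integration.integral_sum[OF int] by (intro sum.cong refl)
  qed
  finally show ?thesis .
qed

text \<open>The case \<open>j = r + 1\<close> of the defining formula: the range
  \<open>{j..r}\<close> is empty, so the condition linking letters to \<open>x\<close> is
  vacuous.\<close>

lemma emeasure_past_cylinder:
  fixes L :: "real ^ 'n ^ 'n" and r :: nat
  assumes "is_conditional_measure L p0 t x M"
    and "\<tau> 0 = 0" "\<And>k. k < r \<Longrightarrow> \<tau> k < \<tau> (Suc k)" "\<tau> r < t"
  shows "emeasure M {w \<in> cadlag_paths. \<forall>k\<le>r. w (\<tau> k) = a k} =
    ennreal (1 / p0 $ x 0 * transition_matrix L (t - \<tau> r) $ x 0 $ a r *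
      (\<Prod>k=1..r. transition_matrix L (\<tau> k - \<tau> (k - 1)) $ a k $ a (k - 1)) * p0 $ a 0)"
proof -
  have "1 \<le> Suc r \<and> Suc r \<le> r + 1 \<and> \<tau> 0 = 0 \<and> (\<forall>k<r. \<tau> k < \<tau> (Suc k)) \<and>
      \<tau> (Suc r - 1) < t \<and> (Suc r \<le> r \<longrightarrow> t \<le> \<tau> (Suc r))"
    using assms(2-4) by simp
  note assms(1)[unfolded is_conditional_measure_def, THEN conjunct2, THEN conjunct2, THEN conjunct2,
      THEN spec[of _ r], THEN spec[of _ "Suc r"], THEN spec[of _ \<tau>], THEN spec[of _ a], THEN mp, OF this]
  then show ?thesis by simp
qed

text \<open>The definition states no total mass. With the single time 0 (\<open>r = 0\<close>,
  \<open>\<tau> = real\<close>) its formula gives each set \<open>w 0 = a\<close> a value of the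
  form \<open>ennreal\<close>, hence a finite one, and finitely many such sets cover the space.
  Finiteness makes constants admissible in dominated convergence.\<close>

lemma finite_measure_conditional:
  fixes L :: "real ^ 'n ^ 'n"
  assumes M: "is_conditional_measure L p0 t x M" and "0 < t"
  shows "finite_measure M"
proof
  have space: "space M = cadlag_paths" and sets: "sets M = sets path_algebra"
    using M by (auto simp: is_conditional_measure_def)
  note [measurable] = measurable_coordinate_of_sets_eq[OF sets, of 0]
  let ?E = "\<lambda>a. {w \<in> space M. w 0 = a}"
  have "emeasure M (?E a) \<noteq> \<infinity>" for a
    using emeasure_past_cylinder[OF M, of real 0 "\<lambda>_. a"] \<open>0 < t\<close> by (simp add: space)
  then have finite_sum: "(\<Sum>a\<in>UNIV. emeasure M (?E a)) < \<infinity>"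
    by (simp add: less_top)
  have "space M = (\<Union>a\<in>UNIV. ?E a)" by auto
  also have "emeasure M \<dots> \<le> (\<Sum>a\<in>UNIV. emeasure M (?E a))"
    by (rule emeasure_subadditive_finite) auto
  finally show "emeasure M (space M) \<noteq> \<infinity>"
    using finite_sum by (intro less_imp_neq) (rule le_less_trans)
qed

lemma transition_matrix_nonneg:
  assumes "generator_matrix L" "0 \<le> h"
  shows "0 \<le> transition_matrix L h $ i $ j"
  using assms unfolding transition_matrix_def generator_matrix_def
  by (intro mat_exp_nonneg) auto

text \<open>Each weight, taken at the right end of a step, joins the transition arriving there,
  which produces the kernel of the weighted step; time 0 carries no weight. The factor
  \<open>p0 $ a 0\<close> of the cylinder formula cancels the denominator of the integrand, and only
  \<open>p0 $ x 0\<close> remains below.\<close>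

lemma integral_riemann_weight:
  fixes L :: "real ^ 'n ^ 'n" and p0 v m :: "real ^ 'n" and N :: nat
  assumes M: "is_conditional_measure L p0 t x M" and t: "0 < t"
    and L: "generator_matrix L" and p0: "\<And>i. 0 < p0 $ i"
  defines "h \<equiv> t / real (Suc N)"
  shows "(\<integral>w. exp (\<Sum>k<Suc N. h * v $ w (real (Suc k) * h)) * (m $ w 0 / p0 $ w 0) \<partial>M) =
    ((\<lambda>f i. \<Sum>j\<in>UNIV. exp (h * v $ i) * transition_matrix L h $ i $ j * f j) ^^ Suc N)
      (\<lambda>i. m $ i) (x 0) / p0 $ x 0"
proof -
  let ?P = "transition_matrix L h"
  let ?\<tau> = "\<lambda>k. real k * h"
  let ?K = "\<lambda>i j. exp (h * v $ i) * ?P $ i $ j"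
  have h: "0 < h" "real (Suc N) * h = t" using t by (auto simp: h_def)
  have space: "space M = cadlag_paths" and sets: "sets M = sets path_algebra"
    using M by (auto simp: is_conditional_measure_def)
  interpret finite_measure M by (rule finite_measure_conditional[OF M t])
  \<comment> \<open>Evaluating \<open>shift t w = x\<close> at 0 fixes the last sample
    \<open>w t\<close>, which belongs to no past cylinder.\<close>
  have end_value: "AE w in M. w t = x 0"
  proof -
    have "AE w in M. shift t w = x" using M by (simp add: is_conditional_measure_def)
    then show ?thesis by eventually_elim (auto simp: shift_def)
  qed
  \<comment> \<open>The integrand as a function of the letters before \<open>t\<close>, with the
    last sample replaced by \<open>x 0\<close>; the two agree almost everywhere by
    \<open>end_value\<close>.\<close>
  define F where "F a = exp ((\<Sum>k=1..N. h * v $ a k) + h * v $ x 0) * (m $ a 0 / p0 $ a 0)"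
    for a :: "nat \<Rightarrow> 'n"
  have cylinder: "measure M {w \<in> cadlag_paths. \<forall>k\<le>N. w (?\<tau> k) = a k} =
      1 / p0 $ x 0 * ?P $ x 0 $ a N * (\<Prod>k=1..N. ?P $ a k $ a (k - 1)) * p0 $ a 0" for a
  proof -
    have step: "?\<tau> k - ?\<tau> (k - 1) = h" if "k \<in> {1..N}" for k
      using that by (simp add: algebra_simps of_nat_diff)
    have last: "t - ?\<tau> N = h" using h by (simp add: algebra_simps)
    have "0 < t - ?\<tau> N" by (simp only: last h(1))
    then have "?\<tau> N < t" by simp
    then have "emeasure M {w \<in> cadlag_paths. \<forall>k\<le>N. w (?\<tau> k) = a k} =
        ennreal (1 / p0 $ x 0 * transition_matrix L (t - ?\<tau> N) $ x 0 $ a N *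
          (\<Prod>k=1..N. transition_matrix L (?\<tau> k - ?\<tau> (k - 1)) $ a k $ a (k - 1)) * p0 $ a 0)"
      using h by (intro emeasure_past_cylinder[OF M]) auto
    also have "\<dots> = ennreal (1 / p0 $ x 0 * ?P $ x 0 $ a N *
        (\<Prod>k=1..N. ?P $ a k $ a (k - 1)) * p0 $ a 0)"
      unfolding last using step by (simp only: cong: prod.cong)
    \<comment> \<open>Since \<open>ennreal\<close> sends negative numbers to 0, reading off the real
      value requires nonnegative transition entries.\<close>
    finally show ?thesis
      using transition_matrix_nonneg[OF L, of h] h p0
      by (simp add: measure_def prod_nonneg less_imp_le)
  qed
  have "(\<integral>w. exp (\<Sum>k<Suc N. h * v $ w (real (Suc k) * h)) * (m $ w 0 / p0 $ w 0) \<partial>M) =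
      (\<integral>w. F (\<lambda>k\<in>{..N}. w (?\<tau> k)) \<partial>M)"
  proof (rule integral_cong_AE)
    show "AE w in M. exp (\<Sum>k<Suc N. h * v $ w (real (Suc k) * h)) * (m $ w 0 / p0 $ w 0) =
        F (\<lambda>k\<in>{..N}. w (?\<tau> k))"
      using end_value
    proof eventually_elim
      case (elim w)
      have "(\<Sum>k<Suc N. h * v $ w (real (Suc k) * h)) = (\<Sum>k<N. h * v $ w (real (Suc k) * h)) + h * v $ x 0"
        using elim h(2) by simp
      also have "(\<Sum>k<N. h * v $ w (real (Suc k) * h)) = (\<Sum>k=1..N. h * v $ w (real k * h))"
        by (simp add: sum.atLeast1_atMost_eq lessThan_atLeast0 del: of_nat_Suc)
      finally show ?case by (simp add: F_def)
    qed
    have coord: "(\<lambda>w. g (w s)) \<in> borel_measurable M" if "0 \<le> s" for g :: "'n \<Rightarrow> real" and s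
      using measurable_coordinate_of_sets_eq[OF sets that]
      by (rule measurable_compose) simp
    have F_eq: "F (\<lambda>k\<in>{..N}. w (?\<tau> k)) =
        exp ((\<Sum>k=1..N. h * v $ w (?\<tau> k)) + h * v $ x 0) * (m $ w 0 / p0 $ w 0)" for w
      by (simp add: F_def)
    show "(\<lambda>w. F (\<lambda>k\<in>{..N}. w (?\<tau> k))) \<in> borel_measurable M"
      unfolding F_eq using h
      by (intro borel_measurable_times borel_measurable_exp borel_measurable_add
          borel_measurable_sum coord borel_measurable_divide measurable_compose[OF _ borel_measurable_exp])
        auto
    show "(\<lambda>w. exp (\<Sum>k<Suc N. h * v $ w (real (Suc k) * h)) * (m $ w 0 / p0 $ w 0)) \<in> borel_measurable M"
      using h
      by (intro borel_measurable_times borel_measurable_sum coord borel_measurable_divide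
          measurable_compose[OF _ borel_measurable_exp]) auto
  qed
  also have "\<dots> = (\<Sum>a\<in>PiE {..N} (\<lambda>_. UNIV). F a * measure M {w \<in> cadlag_paths. \<forall>k\<le>N. w (?\<tau> k) = a k})"
    using h by (intro integral_finite_coordinates finite_measure_axioms space sets) simp
  also have "\<dots> = (\<Sum>a\<in>PiE {..N} (\<lambda>_. UNIV).
      ?K (x 0) (a N) * (\<Prod>k=1..N. ?K (a k) (a (k - 1))) * m $ a 0 / p0 $ x 0)"
    unfolding cylinder F_def exp_add exp_sum[OF finite_atLeastAtMost] prod.distrib
    using p0 by (intro sum.cong) (simp_all add: less_imp_neq[symmetric] field_simps)
  also have "\<dots> = (\<Sum>a\<in>PiE {..N} (\<lambda>_. UNIV).
      ?K (x 0) (a N) * (\<Prod>k=1..N. ?K (a k) (a (k - 1))) * m $ a 0) / p0 $ x 0"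
    by (simp add: sum_divide_distrib)
  also have "\<dots> = ((\<lambda>f i. \<Sum>j\<in>UNIV. ?K i j * f j) ^^ Suc N) (\<lambda>i. m $ i) (x 0) / p0 $ x 0"
    by (simp only: sum_words_eq_iterate[of ?K "x 0" N "\<lambda>i. m $ i"])
  finally show ?thesis .
qed

section \<open>Iterated bounds and the passage to the limit\<close>

text \<open>Applying \<open>K\<close> is linear and, its entries being nonnegative, monotone. Each
  further application thus preserves the previous bounds and contributes one more factor
  \<open>c\<close> or \<open>d\<close>.\<close>

lemma iterate_bounds:
  fixes K :: "'a :: finite \<Rightarrow> 'a \<Rightarrow> real"
  assumes K: "\<And>i j. 0 \<le> K i j" and "0 \<le> c" "0 \<le> d"
    and lower: "\<And>i. c * g i \<le> (\<Sum>j\<in>UNIV. K i j * g j)"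
    and upper: "\<And>i. (\<Sum>j\<in>UNIV. K i j * g j) \<le> d * g i"
  shows "c ^ N * g i \<le> ((\<lambda>f i. \<Sum>j\<in>UNIV. K i j * f j) ^^ N) g i \<and>
    ((\<lambda>f i. \<Sum>j\<in>UNIV. K i j * f j) ^^ N) g i \<le> d ^ N * g i"
proof (induction N arbitrary: i)
  case (Suc N)
  let ?f = "((\<lambda>f i. \<Sum>j\<in>UNIV. K i j * f j) ^^ N) g"
  have "c ^ Suc N * g i \<le> c ^ N * (\<Sum>j\<in>UNIV. K i j * g j)"
    using mult_left_mono[OF lower[of i], of "c ^ N"] \<open>0 \<le> c\<close> by (simp add: mult_ac)
  also have "\<dots> = (\<Sum>j\<in>UNIV. K i j * (c ^ N * g j))"
    by (simp add: sum_distrib_left mult_ac)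
  also have "\<dots> \<le> (\<Sum>j\<in>UNIV. K i j * ?f j)"
    using Suc.IH K by (intro sum_mono mult_left_mono) auto
  finally have *: "c ^ Suc N * g i \<le> (\<Sum>j\<in>UNIV. K i j * ?f j)" .
  have "(\<Sum>j\<in>UNIV. K i j * ?f j) \<le> (\<Sum>j\<in>UNIV. K i j * (d ^ N * g j))"
    using Suc.IH K by (intro sum_mono mult_left_mono) auto
  also have "\<dots> = d ^ N * (\<Sum>j\<in>UNIV. K i j * g j)"
    by (simp add: sum_distrib_left mult_ac)
  also have "\<dots> \<le> d ^ Suc N * g i"
    using mult_left_mono[OF upper[of i], of "d ^ N"] \<open>0 \<le> d\<close> by (simp add: mult_ac)
  finally show ?case using * by simp
qed simp

text \<open>Provides the path that witnesses that the eigenfunction is not identically zero.\<close>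

lemma constant_path_in_cadlag_paths: "(\<lambda>t\<in>{0..}. a) \<in> cadlag_paths"
proof -
  have "eventually (\<lambda>u. restrict (\<lambda>_. a) {0..} u = a) (at_right t)" if "0 \<le> t" for t :: real
    using eventually_at_right_less[of t] by eventually_elim (use that in auto)
  moreover have "\<exists>b. eventually (\<lambda>u. restrict (\<lambda>_. a) {0..} u = b) (at_left t)" if "0 < t" for t :: real
    unfolding eventually_at_left_field by (rule exI[of _ a], rule exI[of _ 0]) (use that in auto)
  ultimately show ?thesis
    by (auto simp: cadlag_paths_def limitin_discrete_iff)
qed

theorem proposition3p3:
  fixes L :: "real ^ 'n ^ 'n"
    and p0 v m :: "real ^ 'n"
    and lam :: real
    and V :: "(real \<Rightarrow> 'n) \<Rightarrow> real"
    and \<mu> :: "real \<Rightarrow> (real \<Rightarrow> 'n) \<Rightarrow> (real \<Rightarrow> 'n) measure"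
  assumes "generator_matrix L"
    and "positive_prob_vector p0" and "L *v p0 = 0"
    and "\<And>t x. t > 0 \<Longrightarrow> x \<in> cadlag_paths \<Longrightarrow> is_conditional_measure L p0 t x (\<mu> t x)"
    and "\<And>w. w \<in> cadlag_paths \<Longrightarrow> V w = v $ w 0"
    and "positive_prob_vector m"
    and "\<And>t. t > 0 \<Longrightarrow> mat_exp (t *\<^sub>R (L + diag_mat v)) *v m = exp (t * lam) *\<^sub>R m"
  shows "\<forall>t>0. is_eigenfunction (weighted_transfer \<mu> V t) (\<lambda>w. m $ w 0 / p0 $ w 0) (exp (t * lam))"
proof (intro allI impI)
  fix t :: real assume t: "0 < t"
  let ?f = "\<lambda>w. m $ w 0 / p0 $ w 0"
  have p0: "0 < p0 $ i" and m: "0 < m $ i" for i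
    using assms(2,6) by (auto simp: positive_prob_vector_def)
  define B where "B = (\<Sum>i\<in>UNIV. \<bar>v $ i\<bar>)"
  define C where "C = (\<Sum>i\<in>UNIV. \<bar>m $ i / p0 $ i\<bar>)"
  have B: "\<bar>v $ i\<bar> \<le> B" for i
    unfolding B_def by (rule member_le_sum) auto
  have C: "\<bar>m $ i / p0 $ i\<bar> \<le> C" for i
    unfolding C_def by (rule member_le_sum[of i UNIV "\<lambda>i. \<bar>m $ i / p0 $ i\<bar>"]) auto
  have coord: "(\<lambda>w. g (w s)) \<in> borel_measurable M"
    if "sets M = sets path_algebra" "0 \<le> s" for g :: "'n \<Rightarrow> real" and s M
    using measurable_coordinate_of_sets_eq[OF that] by (rule measurable_compose) simp
  have "weighted_transfer \<mu> V t ?f x = exp (t * lam) * ?f x" if x: "x \<in> cadlag_paths" for x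
  proof -
    define M where "M = \<mu> t x"
    have M: "is_conditional_measure L p0 t x M"
      unfolding M_def by (rule assms(4)[OF t x])
    have space: "space M = cadlag_paths" and sets: "sets M = sets path_algebra"
      using M by (auto simp: is_conditional_measure_def)
    interpret finite_measure M
      by (rule finite_measure_conditional[OF M t])
    define h where "h N = t / real (Suc N)" for N
    have h: "0 < h N" "real (Suc N) * h N = t" for N
      using t by (auto simp: h_def)
    define S where "S N w = (\<Sum>k<Suc N. h N * v $ w (real (Suc k) * h N))" for N w
    let ?W = "\<lambda>w. LINT s:{0..t}|lborel. V (shift s w)"
    \<comment> \<open>\<open>V\<close> is specified on cadlag paths only, so the shifted path has to
      be one before \<open>V (shift s w)\<close> can be read as \<open>v $ w s\<close>.\<close>
    have S_lim: "(\<lambda>N. S N w) \<longlonglongrightarrow> ?W w" if w: "w \<in> cadlag_paths" for w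
    proof -
      have "V (shift s w) = v $ w s" if "0 \<le> s" for s
        using assms(5)[OF shift_in_cadlag_paths[OF w that]] by (simp add: shift_def)
      then have "?W w = (LINT s:{0..t}|lborel. v $ w s)"
        by (intro set_lebesgue_integral_cong) auto
      then show ?thesis
        unfolding S_def h_def using riemann_sum_cadlag_tendsto[OF w t, of "\<lambda>i. v $ i"] by simp
    qed
    \<comment> \<open>The bound is uniform in \<open>N\<close> and \<open>w\<close>, because the
      \<open>Suc N\<close> steps have total length \<open>t\<close>; it yields the constant
      dominating function.\<close>
    have S_bound: "\<bar>S N w\<bar> \<le> t * B" for N w
    proof -
      have "\<bar>S N w\<bar> \<le> (\<Sum>k<Suc N. h N * B)"
        unfolding S_def using B h(1)[of N]
        by (intro order_trans[OF sum_abs] sum_mono) (simp add: abs_mult)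
      also have "\<dots> = t * B"
        using h(2)[of N] by (simp add: mult.assoc[symmetric] del: of_nat_Suc)
      finally show ?thesis .
    qed
    have S_meas: "(\<lambda>w. exp (S N w) * ?f w) \<in> borel_measurable M" for N
      unfolding S_def using h(1)[of N]
      by (intro borel_measurable_times borel_measurable_sum coord[OF sets] borel_measurable_divide
          measurable_compose[OF _ borel_measurable_exp]) (auto intro: mult_nonneg_nonneg)
    have lim: "(\<lambda>N. exp (S N w) * ?f w) \<longlonglongrightarrow> exp (?W w) * ?f w" if "w \<in> space M" for w
      using that by (intro tendsto_intros S_lim) (simp add: space)
    have W_lim: "(\<lambda>N. \<integral>w. exp (S N w) * ?f w \<partial>M) \<longlonglongrightarrow> (\<integral>w. exp (?W w) * ?f w \<partial>M)"
    proof (rule integral_dominated_convergence)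
      \<comment> \<open>Measurability of the weight with the exact time integral also comes from its
        Riemann approximations.\<close>
      show "(\<lambda>w. exp (?W w) * ?f w) \<in> borel_measurable M"
        using lim S_meas by (rule borel_measurable_LIMSEQ_real)
      show "AE w in M. norm (exp (S N w) * ?f w) \<le> exp (t * B) * C" for N
      proof (rule AE_I2)
        fix w
        have "exp (S N w) \<le> exp (t * B)"
          using S_bound[of N w] by simp
        then have "exp (S N w) * \<bar>?f w\<bar> \<le> exp (t * B) * C"
          by (rule mult_mono[OF _ C]) simp_all
        then show "norm (exp (S N w) * ?f w) \<le> exp (t * B) * C"
          by (simp add: abs_mult)
      qed
    qed (use lim S_meas in auto)
    have W_iterate: "(\<integral>w. exp (S N w) * ?f w \<partial>M) =
        ((\<lambda>f i. \<Sum>j\<in>UNIV. exp (h N * v $ i) * transition_matrix L (h N) $ i $ j * f j) ^^ Suc N)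
          (\<lambda>i. m $ i) (x 0) / p0 $ x 0" for N
      unfolding S_def h_def by (rule integral_riemann_weight[OF M t assms(1) p0])
    have h_lim: "filterlim h (at_right 0) sequentially"
    proof -
      have "h \<longlonglongrightarrow> 0"
        unfolding h_def by (rule LIMSEQ_Suc) (rule lim_const_over_n)
      then show ?thesis
        using h(1) by (intro tendsto_imp_filterlim_at_right) simp_all
    qed
    have bounds: "exp (t * (lam - e)) * ?f x \<le> (\<integral>w. exp (?W w) * ?f w \<partial>M) \<and>
        (\<integral>w. exp (?W w) * ?f w \<partial>M) \<le> exp (t * (lam + e)) * ?f x" if e: "0 < e" for e
    proof -
      let ?G = "\<lambda>h i. exp (h * v $ i) * (\<Sum>j\<in>UNIV. mat_exp (h *\<^sub>R L) $ i $ j * m $ j)"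
      have "eventually (\<lambda>h. \<forall>i. exp (h * (lam - e)) * m $ i \<le> ?G h i \<and>
          ?G h i \<le> exp (h * (lam + e)) * m $ i) (at_right 0)"
        by (rule eventually_eigenvector_step_bounds[OF m e]) (rule assms(7))
      then have "eventually (\<lambda>N. \<forall>i. exp (h N * (lam - e)) * m $ i \<le> ?G (h N) i \<and>
          ?G (h N) i \<le> exp (h N * (lam + e)) * m $ i) sequentially"
        using h_lim by (rule eventually_compose_filterlim)
      then have "eventually (\<lambda>N. exp (t * (lam - e)) * ?f x \<le> (\<integral>w. exp (S N w) * ?f w \<partial>M) \<and>
          (\<integral>w. exp (S N w) * ?f w \<partial>M) \<le> exp (t * (lam + e)) * ?f x) sequentially"
      proof eventually_elim
        case (elim N)
        let ?K = "\<lambda>i j. exp (h N * v $ i) * transition_matrix L (h N) $ i $ j"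
        \<comment> \<open>The steps add up to \<open>t\<close>, so the iterated bounds no longer
          depend on \<open>N\<close> and survive the limit.\<close>
        have pow: "exp (h N * c) ^ Suc N = exp (t * c)" for c
          unfolding exp_of_nat_mult[symmetric] using h(2)[of N] by (simp only: mult.assoc[symmetric])
        have "exp (h N * (lam - e)) ^ Suc N * m $ x 0 \<le>
            ((\<lambda>f i. \<Sum>j\<in>UNIV. ?K i j * f j) ^^ Suc N) (\<lambda>i. m $ i) (x 0) \<and>
            ((\<lambda>f i. \<Sum>j\<in>UNIV. ?K i j * f j) ^^ Suc N) (\<lambda>i. m $ i) (x 0) \<le>
            exp (h N * (lam + e)) ^ Suc N * m $ x 0"
        proof (rule iterate_bounds)
          show "0 \<le> ?K i j" for i j
            using transition_matrix_nonneg[OF assms(1), of "h N" i j] h(1)[of N] by simp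
          show "exp (h N * (lam - e)) * m $ i \<le> (\<Sum>j\<in>UNIV. ?K i j * m $ j)" for i
            using elim by (simp add: sum_distrib_left mult.assoc transition_matrix_def)
          show "(\<Sum>j\<in>UNIV. ?K i j * m $ j) \<le> exp (h N * (lam + e)) * m $ i" for i
            using elim by (simp add: sum_distrib_left mult.assoc transition_matrix_def)
        qed simp_all
        then show ?case
          unfolding W_iterate pow using p0[of "x 0"]
          by (simp only: times_divide_eq_right divide_right_mono less_imp_le simp_thms)
      qed
      then show ?thesis
        using W_lim
        by (intro conjI tendsto_lowerbound[OF W_lim] tendsto_upperbound[OF W_lim])
          (auto elim: eventually_mono)
    qed
    \<comment> \<open>The integral does not depend on \<open>e\<close>, so both bounds may be taken
      to their common limit as \<open>e\<close> tends to 0 from the right.\<close>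
    have "(\<integral>w. exp (?W w) * ?f w \<partial>M) = exp (t * lam) * ?f x"
    proof (rule antisym)
      have "((\<lambda>e. exp (t * (lam + e)) * ?f x) \<longlongrightarrow> exp (t * (lam + 0)) * ?f x) (at_right 0)"
        by (intro tendsto_intros)
      then show "(\<integral>w. exp (?W w) * ?f w \<partial>M) \<le> exp (t * lam) * ?f x"
        using bounds eventually_at_right_less[of "0::real"]
        by (intro tendsto_lowerbound) (auto elim: eventually_mono)
      have "((\<lambda>e. exp (t * (lam - e)) * ?f x) \<longlongrightarrow> exp (t * (lam - 0)) * ?f x) (at_right 0)"
        by (intro tendsto_intros)
      then show "exp (t * lam) * ?f x \<le> (\<integral>w. exp (?W w) * ?f w \<partial>M)"
        using bounds eventually_at_right_less[of "0::real"]
        by (intro tendsto_upperbound) (auto elim: eventually_mono)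
    qed
    then show ?thesis
      by (simp add: weighted_transfer_def transfer_def M_def)
  qed
  moreover have "?f \<in> bounded_measurable"
  proof -
    have "?f ` cadlag_paths \<subseteq> range (\<lambda>i. m $ i / p0 $ i)" by auto
    then have "bounded (?f ` cadlag_paths)"
      by (rule bounded_subset[rotated]) (simp add: finite_imp_bounded)
    then show ?thesis
      unfolding bounded_measurable_def
      using coord[OF refl order_refl, of "\<lambda>i. m $ i / p0 $ i"] by simp
  qed
  moreover have "\<exists>w\<in>cadlag_paths. ?f w \<noteq> 0"
    using p0 m by (intro bexI[OF _ constant_path_in_cadlag_paths]) (simp add: less_imp_neq[symmetric])
  ultimately show "is_eigenfunction (weighted_transfer \<mu> V t) ?f (exp (t * lam))"
    by (simp add: is_eigenfunction_def)
qed

end
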